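(* Let $\mathcal{B}_1:=\widetilde{K_3}(G)$, $\mathcal{B}_2:=\widetilde{P_3}(G)$, $\mathcal{B}_3:=\widetilde{P_4}(G)\cup\widetilde{R}(G)\cup\widetilde{D}(G)$, and $\mathcal{B}_4:=\widetilde{K_4}(G)\cup\widetilde{K_{1,3}}(G)\cup\widetilde{C_4}(G)$. Then: (i) $(V,\mathcal{B}_1)$ forms a $2$-$(q,3,\lambda_1)$-design, where $\lambda_1=\frac14(q-5)$; (ii) $(V,\mathcal{B}_2)$ forms a $2$-$(q,3,\lambda_2)$-design, where $\lambda_2=\frac34(q-1)$; (iii) $(V,\mathcal{B}_3)$ forms a $2$-$(q,4,\lambda_3)$-design, where $\lambda_3=\frac38(q-1)(q-3)$; (iv) $(V,\mathcal{B}_4)$ forms a $2$-$(q,4,\lambda_4)$-design, where $\lambda_4=\frac18(q-3)(q-5)$.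
   Context: Let $p,q,r$ be positive integers with $p$ prime, $q=p^r$ and $q\equiv 1 \pmod 4$. The graph $G$ is fixed as follows. If $r$ is odd or $p\not\equiv 3\pmod 4$, $G$ is the $q$-vertex Paley graph. If $r$ is even and $p\equiv 3\pmod 4$, $G$ is either the $q$-vertex Paley graph or the $q$-vertex Peisert graph (the result holds for either choice). The $q$-vertex Paley graph has vertex set $\mathrm{GF}(q)$ and edges all $\{x,y\}$ with $x\ne y$ and $x-y$ a quadratic residue (nonzero square) in $\mathrm{GF}(q)$. The $q$-vertex Peisert graph (for $p\equiv 3\pmod 4$, $r$ even) has vertex set $\mathrm{GF}(q)$ and edges all $\{x,y\}$ such that $x-y=\omega^j$ for some $j$ with $j\equiv 0$ or $1\pmod 4$, where $\omega$ is a fixed primitive root (generator of the multiplicative group) of $\mathrm{GF}(q)$. $V$ denotes the vertex set of $G$. All graphs are finite and simple. $G[X]$ is the subgraph of $G$ induced by $X\subseteq V$. For a graph $H$, $\overline{H}$ is its complement, $H(G):=\{X\subseteq V: G[X]\cong H\}$, and $\widetilde{H}(G):=H(G)\cup\overline{H}(G)$. $K_t$ is the complete graph on $t$ vertices, $P_t$ the path on $t$ vertices, $C_t$ the cycle on $t$ vertices, $K_{s,t}$ the complete bipartite graph with parts of sizes $s,t$; $D$ (diamond) is $K_4$ minus one edge; $R$ (paw) is the graph obtained from $K_4$ by removing two edges which is not $C_4$ (i.e. a triangle with one pendant edge). A pair $(V,\mathcal{B})$ with $|V|=q$ and $\mathcal{B}$ a set of subsets of $V$ (blocks, none repeated) is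 a $2$-$(q,k,\lambda)$-design if every block has exactly $k$ elements and every pair of distinct elements of $V$ is contained in exactly $\lambda$ blocks; degenerate cases such as $\lambda=0$ are allowed. *)

theory Defs
  imports Complex_Main "HOL-Library.Cardinality" "HOL-Computational_Algebra.Primes" "HOL-Number_Theory.Cong"
begin

section \<open>Simple graphs\<close>

text \<open>Edges are unordered pairs. All graphs built below are simple: every edge is a
  two-element set of vertices.\<close>

datatype 'a ugraph = Ugraph (verts: "'a set") (edges: "'a set set")

definition induced :: "'a ugraph \<Rightarrow> 'a set \<Rightarrow> 'a ugraph" where
  "induced G X = Ugraph X {e \<in> edges G. e \<subseteq> X}"

definition complement :: "'a ugraph \<Rightarrow> 'a ugraph" where
  "complement G = Ugraph (verts G)
     {{x, y} | x y. x \<in> verts G \<and> y \<in> verts G \<and> x \<noteq> y \<and> {x, y} \<notin> edges G}"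

definition isomorphic :: "'a ugraph \<Rightarrow> 'b ugraph \<Rightarrow> bool" where
  "isomorphic G H \<longleftrightarrow> (\<exists>f. bij_betw f (verts G) (verts H) \<and>
     (\<forall>x\<in>verts G. \<forall>y\<in>verts G. {x, y} \<in> edges G \<longleftrightarrow> {f x, f y} \<in> edges H))"

text \<open>\<open>copies H G\<close> and \<open>copies_co H G\<close> are the sets written $H(G)$ and $\widetilde{H}(G)$.\<close>

definition copies :: "'b ugraph \<Rightarrow> 'a ugraph \<Rightarrow> 'a set set" where
  "copies H G = {X. X \<subseteq> verts G \<and> isomorphic (induced G X) H}"

definition copies_co :: "'b ugraph \<Rightarrow> 'a ugraph \<Rightarrow> 'a set set" where
  "copies_co H G = copies H G \<union> copies (complement H) G"


section \<open>The small graphs\<close>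

definition complete_graph :: "nat \<Rightarrow> nat ugraph" where
  "complete_graph t = Ugraph {..<t} {{i, j} | i j. i < t \<and> j < t \<and> i \<noteq> j}"

definition path_graph :: "nat \<Rightarrow> nat ugraph" where
  "path_graph t = Ugraph {..<t} {{i, Suc i} | i. Suc i < t}"

text \<open>Intended for \<open>t \<ge> 3\<close>.\<close>

definition cycle_graph :: "nat \<Rightarrow> nat ugraph" where
  "cycle_graph t = Ugraph {..<t} {{i, Suc i mod t} | i. i < t}"

definition complete_bipartite :: "nat \<Rightarrow> nat \<Rightarrow> nat ugraph" where
  "complete_bipartite s t = Ugraph {..<s + t} {{i, j} | i j. i < s \<and> s \<le> j \<and> j < s + t}"

definition diamond :: "nat ugraph" where
  "diamond = Ugraph {..<4} (edges (complete_graph 4) - {{0, 1}})"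

text \<open>The two removed edges share a vertex (removing two disjoint edges would give $C_4$);
  what remains is the triangle on 1, 2, 3 with the pendant edge from 3 to 0.\<close>

definition paw :: "nat ugraph" where
  "paw = Ugraph {..<4} (edges (complete_graph 4) - {{0, 1}, {0, 2}})"


section \<open>Paley and Peisert graphs\<close>

text \<open>The field $\mathrm{GF}(q)$ is a finite field type with \<open>q\<close> elements. In both graphs
  the condition on \<open>x - y\<close> is independent of the order of \<open>x\<close> and \<open>y\<close> for the orders \<open>q\<close> for
  which they are used: then \<open>-1\<close> is a square, and a fourth power in the Peisert case.\<close>

definition quadratic_residue :: "'a::field \<Rightarrow> bool" where
  "quadratic_residue a \<longleftrightarrow> a \<noteq> 0 \<and> (\<exists>z. a = z ^ 2)"

definition paley_graph :: "'a::{field,finite} ugraph" where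
  "paley_graph = Ugraph UNIV {{x, y} | x y. x \<noteq> y \<and> quadratic_residue (x - y)}"

definition primitive_root :: "'a::field \<Rightarrow> bool" where
  "primitive_root w \<longleftrightarrow> range (\<lambda>j::nat. w ^ j) = UNIV - {0}"

definition peisert_graph :: "'a::{field,finite} \<Rightarrow> 'a ugraph" where
  "peisert_graph w = Ugraph UNIV
     {{x, y} | x y. \<exists>j::nat. ([j = 0] (mod 4) \<or> [j = 1] (mod 4)) \<and> x - y = w ^ j}"


section \<open>Designs\<close>

text \<open>The parameter \<open>\<lambda>\<close> is real so that values given by fractions involve true division and
  subtraction; being equal to a cardinality, it is a natural number (possibly 0) as soon as
  there are two distinct points.\<close>

definition two_design :: "'a set \<Rightarrow> 'a set set \<Rightarrow> nat \<Rightarrow> nat \<Rightarrow> real \<Rightarrow> bool" where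
  "two_design V \<B> v k lam \<longleftrightarrow>
     finite V \<and> card V = v \<and>
     (\<forall>B\<in>\<B>. B \<subseteq> V \<and> card B = k) \<and>
     (\<forall>x\<in>V. \<forall>y\<in>V. x \<noteq> y \<longrightarrow> real (card {B \<in> \<B>. x \<in> B \<and> y \<in> B}) = lam)"

end

theory Submission imports Defs "HOL-Number_Theory.Residues" begin

text \<open>
  Record adjacency by signs: let $S$ be the symmetric matrix with zero diagonal whose entry at two
  distinct vertices is $1$ if they are adjacent and $-1$ if not. The Paley and the Peisert graph are
  both conference graphs: each row of $S$ sums to $0$, and two distinct rows have inner product
  $-1$, so $S^2 = qI - J$ and $SJ = 0$. This alone forces the four designs, because membership in
  each family is a polynomial condition in the signs for which the count through a fixed pair only
  involves entries of $S$, $S^2$ and $S^3$.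

  Three vertices span $K_3$ or its complement when their three signs are equal, and $P_3$ or its
  complement otherwise. For four vertices, the six pairs split into three perfect matchings, and
  each matching has a product of two signs. Running through the eleven graphs on four vertices, the
  three products agree exactly for $K_4$, $K_{1,3}$, $C_4$ and their complements, and they do not
  for $P_4$, the paw, the diamond and their complements. For numbers $a, b, c$ equal to $1$ or $-1$,
  the expression $(1 + ab + ac + bc)/4$ is $1$ if they agree and $0$ if not; summing it over the
  remaining vertices (or ordered pairs of them) gives the counts.

  It remains to see that the two graphs are conference graphs. In both, the sign of a pair is
  $f(x - y)$ for an even function $f$ that vanishes at $0$ and has values $1$ and $-1$ at the
  nonzero elements of the field. Row sums vanish because $f(cz) = -f(z)$ for some $c \neq 0$ and
  all $z$. The condition on inner products is that every autocorrelation
  $A(d) = \sum_z f(z) f(z + d)$ with $d \neq 0$ equals $-1$. As $f$ has sum $0$, these $q - 1$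
  numbers add up to $-(q - 1)$, so it suffices that they are all equal. From $f(cz) = -f(z)$ it
  follows that $A(cd) = A(d)$. Let $\omega$ be a primitive root. For the Paley graph $c = \omega$
  works and all $A(d)$ are equal. For the Peisert graph $c = \omega^2$ works, which leaves $A(1)$
  and $A(\omega)$ to be compared. There $p \equiv 3$ modulo $4$ gives $f(z^p) = f(\omega z)$: both
  $z^p$ and $\omega z$ have an exponent congruent to $0$ or $1$ modulo $4$ exactly when the exponent
  of $z$ is congruent to $0$ or $3$. Since $z \mapsto z^p$ is additive and bijective, substituting
  it in $A(1)$ yields $A(\omega)$.
\<close>

section \<open>Conference graphs\<close>

text \<open>The negative of the usual Seidel matrix.\<close>

definition adj_sign :: "'a ugraph \<Rightarrow> 'a \<Rightarrow> 'a \<Rightarrow> real" where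
  "adj_sign G x y = (if x = y then 0 else if {x, y} \<in> edges G then 1 else -1)"

locale conference_graph =
  fixes G :: "'a ugraph"
  assumes finite_verts: "finite (verts G)"
    and loopless: "{v} \<notin> edges G"
    and row_sum: "x \<in> verts G \<Longrightarrow> (\<Sum>z\<in>verts G. adj_sign G x z) = 0"
    and row_product: "\<lbrakk>x \<in> verts G; y \<in> verts G; x \<noteq> y\<rbrakk>
      \<Longrightarrow> (\<Sum>z\<in>verts G. adj_sign G x z * adj_sign G z y) = -1"

lemma adj_sign_commute: "adj_sign G x y = adj_sign G y x"
  by (simp add: adj_sign_def insert_commute)

lemma adj_sign_square: "x \<noteq> y \<Longrightarrow> adj_sign G x y * adj_sign G x y = 1"
  by (simp add: adj_sign_def)

section \<open>Primitive roots\<close>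

text \<open>The multiplicative group of a finite field is cyclic. The field type is turned into a
  record of ring operations so that the theorem about finite fields given as records applies.\<close>

lemma ex_primitive_root: "\<exists>w::'a::{field,finite}. primitive_root w"
proof -
  define R :: "'a ring" where
    "R = \<lparr>carrier = UNIV, monoid.mult = (*), one = 1, zero = 0, add = (+)\<rparr>"
  have "Ring.cring R"
    by (rule cringI; unfold_locales)
      (auto simp: R_def Units_def algebra_simps intro: add.right_inverse)
  then interpret R: Ring.field R
    by (rule cring.cring_fieldI2) (auto simp: R_def intro: right_inverse)
  have pow: "x [^]\<^bsub>R\<^esub> n = x ^ n" for x :: 'a and n :: nat
    by (induction n) (simp_all add: R_def mult.commute nat_pow_def)
  have "finite (carrier R)" by simp
  then obtain w where "carrier (mult_of R) = {w [^]\<^bsub>R\<^esub> i | i::nat. i \<in> UNIV}"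
    using R.finite_field_mult_group_has_gen by blast
  moreover have "carrier (mult_of R) = UNIV - {0}"
    by (auto simp: R_def)
  ultimately have "range (\<lambda>j::nat. w ^ j) = UNIV - {0}"
    unfolding pow by auto
  then show ?thesis unfolding primitive_root_def by blast
qed

lemma primitive_root_nonzero:
  assumes "primitive_root (w :: 'a::field)"
  shows "w \<noteq> 0"
proof -
  have "w ^ 1 \<in> UNIV - {0}" using assms unfolding primitive_root_def by blast
  then show ?thesis by simp
qed

lemma primitive_root_exponent:
  assumes "primitive_root (w :: 'a::field)" and "z \<noteq> 0"
  obtains j :: nat where "z = w ^ j"
  using assms unfolding primitive_root_def by (metis DiffI UNIV_I imageE singletonD)

text \<open>The pigeonhole principle gives a positive exponent $m \le q - 1$ with $w^m = 1$. The
  powers of $w$ then take at most $m$ values, but there are $q - 1$ of them, so $m = q - 1$ and the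
  first $q - 1$ powers are distinct.\<close>

lemma primitive_root_power_eq_iff:
  fixes w :: "'a::{field,finite}"
  assumes w: "primitive_root w"
  shows "w ^ i = w ^ j \<longleftrightarrow> [i = j] (mod (CARD('a) - 1))"
proof -
  define n where "n = CARD('a) - 1"
  have range: "range (\<lambda>j::nat. w ^ j) = UNIV - {0}"
    using w by (simp add: primitive_root_def)
  have card_range: "card (range (\<lambda>j::nat. w ^ j)) = n"
    unfolding range n_def by (simp add: card_Diff_singleton)
  have w0: "w \<noteq> 0" by (rule primitive_root_nonzero[OF w])
  have "\<not> inj_on (\<lambda>j::nat. w ^ j) {..n}"
  proof
    assume "inj_on (\<lambda>j::nat. w ^ j) {..n}"
    then have "card {..n} \<le> card (range (\<lambda>j::nat. w ^ j))"
      by (intro card_inj_on_le[where f = "\<lambda>j. w ^ j"]) auto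
    then show False using card_range by simp
  qed
  then obtain k l where kl: "k < l" "l \<le> n" "w ^ k = w ^ l"
    unfolding inj_on_def by (metis atMost_iff linorder_neqE_nat)
  define m where "m = l - k"
  have "w ^ k * w ^ m = w ^ k * 1"
    using kl unfolding m_def power_add[symmetric] by simp
  then have wm: "w ^ m = 1" using w0 by simp
  have m: "0 < m" "m \<le> n" using kl by (auto simp: m_def)
  have reduce: "w ^ a = w ^ (a mod m)" for a
  proof -
    have "w ^ a = w ^ (m * (a div m) + a mod m)" by simp
    also have "\<dots> = w ^ (a mod m)" unfolding power_add power_mult wm by simp
    finally show ?thesis .
  qed
  have "range (\<lambda>j::nat. w ^ j) = (\<lambda>j. w ^ j) ` {..<m}"
    using reduce m(1) by (auto intro!: image_eqI[where f = "\<lambda>j. w ^ j", OF reduce])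
  then have card_image: "card ((\<lambda>j. w ^ j) ` {..<m}) = n" using card_range by simp
  then have mn: "m = n"
    using m(2) card_image_le[of "{..<m}" "\<lambda>j. w ^ j"] by simp
  then have "inj_on (\<lambda>j. w ^ j) {..<m}"
    using card_image by (intro eq_card_imp_inj_on) auto
  moreover have "i mod m \<in> {..<m}" "j mod m \<in> {..<m}" using m(1) by auto
  ultimately have "w ^ (i mod m) = w ^ (j mod m) \<longleftrightarrow> i mod m = j mod m"
    by (rule inj_on_eq_iff)
  then show ?thesis
    using reduce[of i] reduce[of j] mn by (simp add: cong_def n_def)
qed

lemma primitive_root_power_half:
  fixes w :: "'a::{field,finite}"
  assumes w: "primitive_root w" and even: "even (CARD('a) - 1)"
  shows "w ^ ((CARD('a) - 1) div 2) = -1"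
proof -
  define h where "h = (CARD('a) - 1) div 2"
  have "CARD('a) \<ge> 2"
    using card_mono[of UNIV "{0, 1 :: 'a}"] by simp
  then have h: "CARD('a) - 1 = 2 * h" "h > 0" using even unfolding h_def by presburger+
  have "w ^ (2 * h) = w ^ 0"
    unfolding primitive_root_power_eq_iff[OF w] h(1) by (simp add: cong_def)
  then have "(w ^ h)\<^sup>2 = 1" by (simp add: power_mult mult.commute)
  moreover have "w ^ h \<noteq> w ^ 0"
    unfolding primitive_root_power_eq_iff[OF w] h(1) using h(2) by (simp add: cong_def)
  ultimately show ?thesis by (simp add: power2_eq_1_iff h_def)
qed

section \<open>Difference graphs\<close>

definition pm_indicator :: "('a::zero \<Rightarrow> bool) \<Rightarrow> 'a \<Rightarrow> real" where
  "pm_indicator P z = (if z = 0 then 0 else if P z then 1 else -1)"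

definition autocorrelation :: "('a::{ab_group_add,finite} \<Rightarrow> real) \<Rightarrow> 'a \<Rightarrow> real" where
  "autocorrelation f d = (\<Sum>z\<in>UNIV. f z * f (z + d))"

text \<open>The autocorrelations at all nonzero shifts together sum each $f(z)$ against all other
  values of $f$, that is against $-f(z)$.\<close>

lemma autocorrelation_eq_minus_one:
  fixes f :: "'a::{ab_group_add,finite} \<Rightarrow> real"
  assumes f0: "f 0 = 0" and f1: "\<And>z. z \<noteq> 0 \<Longrightarrow> f z * f z = 1"
    and sum0: "(\<Sum>z\<in>UNIV. f z) = 0"
    and const: "\<And>d. d \<noteq> 0 \<Longrightarrow> autocorrelation f d = c"
    and d: "d \<noteq> 0"
  shows "autocorrelation f d = -1"
proof -
  have card2: "card (UNIV - {0 :: 'a}) > 0"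
    unfolding card_gt_0_iff using d by auto
  have inner: "(\<Sum>e\<in>UNIV - {0}. f (z + e)) = - f z" for z
  proof -
    have "(\<Sum>e\<in>UNIV. f (z + e)) = (\<Sum>e\<in>UNIV. f e)"
      by (rule sum.reindex_bij_betw[OF bij_betw_byWitness[where f' = "\<lambda>e. e - z"]]) auto
    then show ?thesis using sum0 by (simp add: sum_diff1)
  qed
  have "real (card (UNIV - {0 :: 'a})) * c = (\<Sum>e\<in>UNIV - {0}. autocorrelation f e)"
    using const by simp
  also have "\<dots> = (\<Sum>z\<in>UNIV. f z * (\<Sum>e\<in>UNIV - {0}. f (z + e)))"
    unfolding autocorrelation_def by (subst sum.swap) (simp add: sum_distrib_left)
  also have "\<dots> = - (\<Sum>z\<in>UNIV. f z * f z)"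
    unfolding inner by (simp add: sum_negf)
  also have "(\<Sum>z\<in>UNIV. f z * f z) = (\<Sum>z\<in>UNIV - {0 :: 'a}. 1)"
    by (intro sum.mono_neutral_cong_right) (auto simp: f0 f1)
  finally have "real (card (UNIV - {0 :: 'a})) * (c + 1) = 0"
    by (simp only: distrib_left sum_constant)
  then have "c = -1" using card2 by simp
  then show ?thesis using const[OF d] by simp
qed

lemma bij_mult_nonzero: "(c :: 'a::field) \<noteq> 0 \<Longrightarrow> bij (\<lambda>z. c * z)"
  by (rule bij_betw_byWitness[where f' = "\<lambda>z. z / c"]) auto

text \<open>Substituting $cz$ for $z$ changes the sign of both factors.\<close>

lemma autocorrelation_scale:
  fixes f :: "'a::{field,finite} \<Rightarrow> real"
  assumes c: "c \<noteq> 0" and anti: "\<And>z. f (c * z) = - f z"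
  shows "autocorrelation f (c * d) = autocorrelation f d"
proof -
  have "autocorrelation f (c * d) = (\<Sum>z\<in>UNIV. f (c * z) * f (c * z + c * d))"
    unfolding autocorrelation_def
    by (rule sum.reindex_bij_betw[OF bij_mult_nonzero[OF c], symmetric])
  also have "\<dots> = autocorrelation f d"
    unfolding autocorrelation_def by (simp add: anti flip: distrib_left)
  finally show ?thesis .
qed

text \<open>Scaling by $c$ exchanges the elements that satisfy $P$ with the nonzero ones that do not,
  so they are equally many and the rows of signs sum to $0$. Inner products of two rows are
  autocorrelations at the difference of the two vertices.\<close>

lemma conference_graph_difference_graph:
  fixes P :: "'a::{field,finite} \<Rightarrow> bool"
  assumes P0: "\<not> P 0" and minus: "\<And>z. P (- z) \<longleftrightarrow> P z"
    and c: "c \<noteq> 0" and anti: "\<And>z. z \<noteq> 0 \<Longrightarrow> P (c * z) \<longleftrightarrow> \<not> P z"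
    and const: "\<And>d. d \<noteq> 0 \<Longrightarrow> autocorrelation (pm_indicator P) d
      = autocorrelation (pm_indicator P) 1"
  shows "conference_graph (Ugraph UNIV {{x, y} | x y. P (x - y)})" (is "conference_graph ?G")
proof -
  let ?f = "pm_indicator P"
  have mem: "{x, y} \<in> edges ?G \<longleftrightarrow> P (x - y)" for x y
    using minus[of "x - y"] by (auto simp: doubleton_eq_iff)
  have sign: "adj_sign ?G x y = ?f (y - x)" for x y
    unfolding adj_sign_def pm_indicator_def mem using minus[of "x - y"] by simp
  have f_minus: "?f (- z) = ?f z" for z
    by (simp add: pm_indicator_def minus)
  have f_anti: "?f (c * z) = - ?f z" for z
    using c anti by (simp add: pm_indicator_def)
  have "(\<Sum>z\<in>UNIV. ?f z) = (\<Sum>z\<in>UNIV. ?f (c * z))"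
    by (rule sum.reindex_bij_betw[OF bij_mult_nonzero[OF c], symmetric])
  also have "\<dots> = - (\<Sum>z\<in>UNIV. ?f z)"
    by (simp add: f_anti sum_negf)
  finally have sum0: "(\<Sum>z\<in>UNIV. ?f z) = 0" by simp
  have shift: "(\<Sum>z\<in>UNIV. h (z - x)) = (\<Sum>z\<in>UNIV. h z)" for h :: "'a \<Rightarrow> real" and x
    by (rule sum.reindex_bij_betw[OF bij_betw_byWitness[where f' = "\<lambda>z. z + x"]]) auto
  show ?thesis
  proof
    show "finite (verts ?G)" by simp
    show "{v} \<notin> edges ?G" for v
      using mem[of v v] P0 by simp
    show "(\<Sum>z\<in>verts ?G. adj_sign ?G x z) = 0" for x
      unfolding sign using shift[of ?f x] sum0 by simp
    show "(\<Sum>z\<in>verts ?G. adj_sign ?G x z * adj_sign ?G z y) = -1" if "x \<noteq> y" for x y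
    proof -
      have "(\<Sum>z\<in>UNIV. ?f (z - x) * ?f (y - z)) = (\<Sum>z\<in>UNIV. ?f (z - x) * ?f ((z - x) + (x - y)))"
        using f_minus[of "y - _"] by simp
      also have "\<dots> = autocorrelation ?f (x - y)"
        unfolding autocorrelation_def by (rule shift)
      also have "\<dots> = -1"
        by (rule autocorrelation_eq_minus_one[OF _ _ sum0 const])
          (use that in \<open>auto simp: pm_indicator_def\<close>)
      finally show ?thesis unfolding sign by simp
    qed
  qed
qed

text \<open>The residues are the even powers of a primitive root $w$. The exponent of $-1$ is
  $(q - 1)/2$, which is even by the congruence on $q$, so adjacency is symmetric; multiplication
  by $w$ exchanges residues and nonresidues and connects any two nonzero shifts.\<close>

lemma conference_graph_paley:
  assumes card: "[CARD('a::{field,finite}) = 1] (mod 4)"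
  shows "conference_graph (paley_graph :: 'a ugraph)"
proof -
  obtain w :: 'a where w: "primitive_root w" using ex_primitive_root by blast
  have w0: "w \<noteq> 0" by (rule primitive_root_nonzero[OF w])
  have card4: "4 dvd CARD('a) - 1"
    using card by (metis cong_to_1_nat)
  have qr: "quadratic_residue (w ^ j) \<longleftrightarrow> even j" for j
  proof
    assume "quadratic_residue (w ^ j)"
    then obtain z where z: "w ^ j = z\<^sup>2"
      by (auto simp: quadratic_residue_def)
    with w0 have z0: "z \<noteq> 0" by (metis power_eq_0_iff zero_power2)
    obtain i where "z = w ^ i" using primitive_root_exponent[OF w z0] .
    then have "w ^ j = w ^ (2 * i)" using z by (simp add: power_mult mult.commute)
    then have "[j = 2 * i] (mod (CARD('a) - 1))"
      by (simp add: primitive_root_power_eq_iff[OF w])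
    then have "[j = 2 * i] (mod 2)"
      by (rule cong_dvd_modulus_nat) (use card4 in presburger)
    then show "even j" by (simp add: cong_def even_iff_mod_2_eq_zero)
  next
    assume "even j"
    then obtain i where "j = 2 * i" by blast
    then have "w ^ j = (w ^ i)\<^sup>2" by (simp add: power_mult mult.commute)
    then show "quadratic_residue (w ^ j)" using w0 unfolding quadratic_residue_def by auto
  qed
  have m1: "w ^ ((CARD('a) - 1) div 2) = -1"
    using card4 by (intro primitive_root_power_half[OF w]) presburger
  have even_half: "even ((CARD('a) - 1) div 2)" using card4 by presburger
  have anti: "quadratic_residue (w * z) \<longleftrightarrow> \<not> quadratic_residue z" if z: "z \<noteq> 0" for z
  proof -
    obtain j where "z = w ^ j" using primitive_root_exponent[OF w z] .
    then show ?thesis using qr[of j] qr[of "Suc j"] by simp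
  qed
  have minus: "quadratic_residue (- z) \<longleftrightarrow> quadratic_residue z" for z :: 'a
  proof (cases "z = 0")
    case False
    obtain j where j: "z = w ^ j" using primitive_root_exponent[OF w False] .
    then have "- z = w ^ (j + (CARD('a) - 1) div 2)" unfolding power_add m1 by simp
    then show ?thesis using qr j even_half by simp
  qed simp
  let ?A = "autocorrelation (pm_indicator (quadratic_residue :: 'a \<Rightarrow> bool))"
  have step: "?A (w * d) = ?A d" for d
    by (rule autocorrelation_scale[OF w0])
      (use w0 anti in \<open>simp add: pm_indicator_def\<close>)
  have const: "?A d = ?A 1" if d: "d \<noteq> 0" for d
  proof -
    obtain j where "d = w ^ j" using primitive_root_exponent[OF w d] .
    moreover have "?A (w ^ j) = ?A 1" by (induction j) (simp_all add: step)
    ultimately show ?thesis by simp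
  qed
  have "conference_graph (Ugraph UNIV {{x, y} | x y :: 'a. quadratic_residue (x - y)})"
    by (rule conference_graph_difference_graph[OF _ minus w0 anti const])
      (simp_all add: quadratic_residue_def)
  moreover have "(paley_graph :: 'a ugraph)
      = Ugraph UNIV {{x, y} | x y. quadratic_residue (x - y)}"
    by (auto simp: paley_graph_def quadratic_residue_def)
  ultimately show ?thesis by simp
qed

lemma CHAR_eq_of_card_prime_power:
  assumes "prime p" and "CARD('a::{field,finite}) = p ^ r"
  shows "CHAR('a) = p"
proof -
  have "CHAR('a) > 0" by (rule finite_imp_CHAR_pos) simp
  then have "prime CHAR('a)" by (rule prime_CHAR_semidom)
  moreover have "CHAR('a) dvd p ^ r" using CHAR_dvd_CARD[where 'a = 'a] assms(2) by simp
  ultimately show ?thesis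
    using assms(1) by (metis prime_dvd_power primes_dvd_imp_eq)
qed

text \<open>As $q$ is an odd square, $8$ divides $q - 1$. Hence exponents are determined modulo $4$, and
  the exponent $(q - 1)/2$ of $-1$ is a multiple of $4$. Exponents modulo $4$ are multiplied by
  $3$ under $z \mapsto z^p$, which sends the classes $0, 1, 2, 3$ to $0, 3, 2, 1$, whereas
  multiplication by $w$ sends them to $1, 2, 3, 0$: both maps send exactly the classes $0$ and $3$
  to the edge classes $0$ and $1$.\<close>

lemma conference_graph_peisert:
  fixes w :: "'a::{field,finite}"
  assumes p: "prime p" "[p = 3] (mod 4)" and card: "CARD('a) = p ^ r" and r: "even r" "r > 0"
    and w: "primitive_root w"
  shows "conference_graph (peisert_graph w)"
proof -
  define P where "P z \<longleftrightarrow> (\<exists>j::nat. ([j = 0] (mod 4) \<or> [j = 1] (mod 4)) \<and> z = w ^ j)" for z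
  have w0: "w \<noteq> 0" by (rule primitive_root_nonzero[OF w])
  have p4: "p mod 4 = 3" using p(2) by (simp add: cong_def)
  have card8: "8 dvd CARD('a) - 1"
  proof -
    obtain k where k: "r = 2 * k" using r by blast
    have "odd (p ^ k)" using p4 by simp presburger
    then obtain m where m: "p ^ k = 2 * m + 1" by (rule oddE)
    have "CARD('a) = (2 * m + 1)\<^sup>2"
      unfolding card k using m by (metis power_mult mult.commute)
    then have "CARD('a) - 1 = 4 * (m * (m + 1))"
      by (simp add: power2_eq_square algebra_simps)
    moreover obtain l where "m * (m + 1) = 2 * l" by (metis evenE even_mult_iff even_plus_one_iff)
    ultimately have "CARD('a) - 1 = 8 * l" by simp
    then show ?thesis by simp
  qed
  have P_power: "P (w ^ j) \<longleftrightarrow> j mod 4 = 0 \<or> j mod 4 = 1" for j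
  proof
    assume "P (w ^ j)"
    then obtain i where i: "i mod 4 = 0 \<or> i mod 4 = 1" "w ^ j = w ^ i"
      unfolding P_def cong_def by (metis mod_0 mod_less one_less_numeral_iff semiring_norm(76))
    then have "[j = i] (mod (CARD('a) - 1))"
      by (simp add: primitive_root_power_eq_iff[OF w])
    then have "[j = i] (mod 4)"
      by (rule cong_dvd_modulus_nat) (use card8 in presburger)
    then show "j mod 4 = 0 \<or> j mod 4 = 1" using i(1) by (simp add: cong_def)
  next
    assume "j mod 4 = 0 \<or> j mod 4 = 1"
    then have "[j = 0] (mod 4) \<or> [j = 1] (mod 4)" by (simp add: cong_def)
    then show "P (w ^ j)" unfolding P_def by blast
  qed
  have P0: "\<not> P 0" using w0 by (auto simp: P_def)
  have m1: "w ^ ((CARD('a) - 1) div 2) = -1"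
    using card8 by (intro primitive_root_power_half[OF w]) presburger
  have half: "(CARD('a) - 1) div 2 mod 4 = 0" using card8 by presburger
  have minus: "P (- z) \<longleftrightarrow> P z" for z
  proof (cases "z = 0")
    case False
    obtain j where j: "z = w ^ j" using primitive_root_exponent[OF w False] .
    then have "- z = w ^ (j + (CARD('a) - 1) div 2)" unfolding power_add m1 by simp
    moreover have "(j + (CARD('a) - 1) div 2) mod 4 = j mod 4"
      by (metis half mod_add_right_eq add_0_right)
    ultimately show ?thesis using j by (simp add: P_power)
  qed simp
  have anti: "P (w\<^sup>2 * z) \<longleftrightarrow> \<not> P z" if z: "z \<noteq> 0" for z
  proof -
    obtain j where j: "z = w ^ j" using primitive_root_exponent[OF w z] .
    then have "w\<^sup>2 * z = w ^ (2 + j)" by (simp only: power_add)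
    moreover have "((2 + j) mod 4 = 0 \<or> (2 + j) mod 4 = 1)
        \<longleftrightarrow> \<not> (j mod 4 = 0 \<or> j mod 4 = 1)"
      by presburger
    ultimately show ?thesis using P_power j by metis
  qed
  let ?f = "pm_indicator P"
  let ?A = "autocorrelation ?f"
  have frob_f: "?f (z ^ p) = ?f (w * z)" for z
  proof (cases "z = 0")
    case False
    obtain j where j: "z = w ^ j" using primitive_root_exponent[OF w False] .
    have "(p * j) mod 4 = (3 * j) mod 4" using mod_mult_left_eq[of p 4 j] p4 by simp
    moreover have "((3 * j) mod 4 = 0 \<or> (3 * j) mod 4 = 1)
        \<longleftrightarrow> (Suc j mod 4 = 0 \<or> Suc j mod 4 = 1)"
      by presburger
    ultimately have "((p * j) mod 4 = 0 \<or> (p * j) mod 4 = 1)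
        \<longleftrightarrow> (Suc j mod 4 = 0 \<or> Suc j mod 4 = 1)"
      by simp
    moreover have "z ^ p = w ^ (p * j)" "w * z = w ^ Suc j"
      by (simp_all add: j mult.commute flip: power_mult)
    ultimately have "P (z ^ p) \<longleftrightarrow> P (w * z)" using P_power by metis
    then show ?thesis using w0 False by (simp add: pm_indicator_def)
  qed (use p(1) in \<open>simp add: pm_indicator_def prime_gt_0_nat\<close>)
  have "CHAR('a) = p" by (rule CHAR_eq_of_card_prime_power[OF p(1) card])
  then have add_pow: "(x + y) ^ p = x ^ p + y ^ p" for x y :: 'a
    using p(1) by (intro freshmans_dream) auto
  have "inj (\<lambda>z :: 'a. z ^ p)"
  proof (rule injI)
    fix x y :: 'a assume "x ^ p = y ^ p"
    then have "(x - y) ^ p = 0" using add_pow[of "x - y" y] by simp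
    then show "x = y" by simp
  qed
  then have frob_bij: "bij (\<lambda>z :: 'a. z ^ p)"
    by (simp add: bij_def finite_UNIV_inj_surj)
  have "?A 1 = (\<Sum>z\<in>UNIV. ?f (z ^ p) * ?f (z ^ p + 1))"
    unfolding autocorrelation_def by (rule sum.reindex_bij_betw[OF frob_bij, symmetric])
  also have "\<dots> = (\<Sum>z\<in>UNIV. ?f (z ^ p) * ?f ((z + 1) ^ p))"
    by (simp add: add_pow)
  also have "\<dots> = (\<Sum>z\<in>UNIV. ?f (w * z) * ?f (w * z + w))"
    by (simp add: frob_f distrib_left)
  also have "\<dots> = ?A w"
    unfolding autocorrelation_def by (rule sum.reindex_bij_betw[OF bij_mult_nonzero[OF w0]])
  finally have A1w: "?A 1 = ?A w" .
  have step: "?A (w\<^sup>2 * d) = ?A d" for d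
    by (rule autocorrelation_scale) (use w0 anti in \<open>simp_all add: pm_indicator_def\<close>)
  have const: "?A d = ?A 1" if d: "d \<noteq> 0" for d
  proof -
    obtain j where "d = w ^ j" using primitive_root_exponent[OF w d] .
    moreover have "?A (w ^ j) = ?A 1"
    proof (induction j rule: less_induct)
      case (less j)
      \<comment> \<open>Steps of two in the exponent reduce every shift to 1 or \<open>w\<close>.\<close>
      consider "j = 0" | "j = 1" | i where "j = 2 + i"
        by (metis One_nat_def Suc_1 add_2_eq_Suc not0_implies_Suc)
      then show ?case
        by cases (use A1w less.IH step in \<open>simp_all only: power_add, simp_all\<close>)
    qed
    ultimately show ?thesis by simp
  qed
  have "conference_graph (Ugraph UNIV {{x, y} | x y. P (x - y)})"
    by (rule conference_graph_difference_graph[OF P0 minus _ anti const])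
      (use w0 in simp_all)
  then show ?thesis by (simp add: peisert_graph_def P_def)
qed

section \<open>Graphs on three and four vertices\<close>

text \<open>An isomorphism onto a graph with vertices $0, \dots, n - 1$ is an enumeration of $X$. Only
  pairs of positions $i < j$ matter, since neither graph has loops.\<close>

lemma isomorphic_induced_iff:
  fixes H :: "nat ugraph"
  assumes "\<And>v. {v} \<notin> edges G" and "\<And>i. {i} \<notin> edges H"
    and H: "verts H = {..<n}"
  shows "isomorphic (induced G X) H \<longleftrightarrow>
    (\<exists>xs. distinct xs \<and> length xs = n \<and> set xs = X \<and>
      (\<forall>j<n. \<forall>i<j. {xs ! i, xs ! j} \<in> edges G \<longleftrightarrow> {i, j} \<in> edges H))"
    (is "_ \<longleftrightarrow> (\<exists>xs. ?good xs)")
proof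
  assume "isomorphic (induced G X) H"
  then obtain f where f: "bij_betw f X {..<n}"
    and edge: "\<And>x y. x \<in> X \<Longrightarrow> y \<in> X \<Longrightarrow> {x, y} \<in> edges G \<longleftrightarrow> {f x, f y} \<in> edges H"
    unfolding isomorphic_def induced_def H by auto
  define g where "g = inv_into X f"
  have g: "bij_betw g {..<n} X" unfolding g_def by (rule bij_betw_inv_into[OF f])
  have fg: "f (g i) = i" if "i < n" for i
    unfolding g_def using that by (intro bij_betw_inv_into_right[OF f]) simp
  have gX: "g i \<in> X" if "i < n" for i
    using g that by (auto simp: bij_betw_def)
  have "?good (map g [0..<n])"
    using g by (auto simp: distinct_map bij_betw_def atLeast0LessThan edge[OF gX gX] fg)
  then show "\<exists>xs. ?good xs" by blast
next
  assume "\<exists>xs. ?good xs"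
  then obtain xs where xs: "distinct xs" "length xs = n" "set xs = X"
    and edge: "\<And>i j. i < j \<Longrightarrow> j < n \<Longrightarrow> {xs ! i, xs ! j} \<in> edges G \<longleftrightarrow> {i, j} \<in> edges H"
    by blast
  have g: "bij_betw ((!) xs) {..<n} X"
    using xs by (intro bij_betw_nth) auto
  define f where "f = inv_into {..<n} ((!) xs)"
  have f: "bij_betw f X {..<n}" unfolding f_def by (rule bij_betw_inv_into[OF g])
  have gf: "xs ! f x = x" if "x \<in> X" for x
    unfolding f_def using that by (rule bij_betw_inv_into_right[OF g])
  have fn: "f x < n" if "x \<in> X" for x
    using f that by (auto simp: bij_betw_def)
  have edge': "{xs ! i, xs ! j} \<in> edges G \<longleftrightarrow> {i, j} \<in> edges H" if "i < n" "j < n" for i j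
    using edge[of i j] edge[of j i] that assms(1,2)
    by (cases i j rule: linorder_cases) (auto simp: insert_commute)
  have "{x, y} \<in> edges G \<longleftrightarrow> {f x, f y} \<in> edges H" if "x \<in> X" "y \<in> X" for x y
    using edge'[OF fn fn] gf that by metis
  then show "isomorphic (induced G X) H"
    unfolding isomorphic_def induced_def H using f by auto
qed

lemma copies_co_subset: "X \<in> copies_co H G \<Longrightarrow> X \<subseteq> verts G"
  by (auto simp: copies_co_def copies_def)

text \<open>The truth value $t$ tells whether the enumeration matches $H$ or its complement, so that
  later arguments treat both at once.\<close>

lemma mem_copies_co_iff:
  fixes H :: "nat ugraph"
  assumes loops: "\<And>v. {v} \<notin> edges G" "\<And>i. {i} \<notin> edges H"
    and H: "verts H = {..<n}"
  shows "X \<in> copies_co H G \<longleftrightarrow> X \<subseteq> verts G \<and>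
    (\<exists>xs t. distinct xs \<and> length xs = n \<and> set xs = X \<and>
      (\<forall>j<n. \<forall>i<j. {xs ! i, xs ! j} \<in> edges G \<longleftrightarrow> ({i, j} \<in> edges H) = t))"
proof -
  let ?pattern = "\<lambda>xs t. \<forall>j<n. \<forall>i<j. {xs ! i, xs ! j} \<in> edges G \<longleftrightarrow> ({i, j} \<in> edges H) = t"
  have co_edge: "{i, j} \<in> edges (complement H) \<longleftrightarrow> {i, j} \<notin> edges H" if "i < j" "j < n" for i j
  proof
    assume "{i, j} \<notin> edges H"
    then show "{i, j} \<in> edges (complement H)"
      using that unfolding complement_def H by fastforce
  qed (auto simp: complement_def)
  have co_loopless: "{i} \<notin> edges (complement H)" for i
    by (auto simp: complement_def)
  have co_verts: "verts (complement H) = {..<n}"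
    by (simp add: complement_def H)
  have "isomorphic (induced G X) (complement H) \<longleftrightarrow>
      (\<exists>xs. distinct xs \<and> length xs = n \<and> set xs = X \<and> ?pattern xs False)"
    by (subst isomorphic_induced_iff[OF loops(1) co_loopless co_verts]) (simp add: co_edge cong: conj_cong)
  moreover have "isomorphic (induced G X) H \<longleftrightarrow>
      (\<exists>xs. distinct xs \<and> length xs = n \<and> set xs = X \<and> ?pattern xs True)"
    by (subst isomorphic_induced_iff[OF loops H]) simp
  ultimately show ?thesis
    unfolding copies_co_def copies_def Un_iff mem_Collect_eq ex_bool_eq by blast
qed

lemma ex_list3: "(\<exists>xs. length xs = 3 \<and> Q xs) \<longleftrightarrow> (\<exists>a b c. Q [a, b, c])"
proof
  assume "\<exists>a b c. Q [a, b, c]"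
  then obtain a b c where "length [a, b, c] = 3 \<and> Q [a, b, c]" by auto
  then show "\<exists>xs. length xs = 3 \<and> Q xs" by blast
qed (auto simp: numeral_3_eq_3 length_Suc_conv)

lemma ex_list4: "(\<exists>xs. length xs = 4 \<and> Q xs) \<longleftrightarrow> (\<exists>a b c d. Q [a, b, c, d])"
proof
  assume "\<exists>a b c d. Q [a, b, c, d]"
  then obtain a b c d where "length [a, b, c, d] = 4 \<and> Q [a, b, c, d]" by auto
  then show "\<exists>xs. length xs = 4 \<and> Q xs" by blast
qed (auto simp: eval_nat_numeral length_Suc_conv)

lemma mem_copies_co_3_iff:
  fixes H :: "nat ugraph"
  assumes loops: "\<And>v. {v} \<notin> edges G" "\<And>i. {i} \<notin> edges H"
    and H: "verts H = {..<3}"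
  shows "X \<in> copies_co H G \<longleftrightarrow> X \<subseteq> verts G \<and>
    (\<exists>a b c t. distinct [a, b, c] \<and> X = {a, b, c} \<and>
      ({a, b} \<in> edges G \<longleftrightarrow> ({0, 1} \<in> edges H) = t) \<and>
      ({a, c} \<in> edges G \<longleftrightarrow> ({0, 2} \<in> edges H) = t) \<and>
      ({b, c} \<in> edges G \<longleftrightarrow> ({1, 2} \<in> edges H) = t))"
proof -
  have all: "(\<forall>j<3. \<forall>i<j. R i j) \<longleftrightarrow> R 0 1 \<and> R 0 2 \<and> R 1 (2::nat)" for R
    by (auto simp: numeral_3_eq_3 numeral_2_eq_2 All_less_Suc)
  have "(\<exists>xs t. distinct xs \<and> length xs = 3 \<and> set xs = X \<and>
      (\<forall>j<3. \<forall>i<j. {xs ! i, xs ! j} \<in> edges G \<longleftrightarrow> ({i, j} \<in> edges H) = t))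
    \<longleftrightarrow> (\<exists>xs. length xs = 3 \<and> (\<exists>t. distinct xs \<and> set xs = X \<and>
      (\<forall>j<3. \<forall>i<j. {xs ! i, xs ! j} \<in> edges G \<longleftrightarrow> ({i, j} \<in> edges H) = t)))"
    by blast
  also have "\<dots> \<longleftrightarrow> (\<exists>a b c t. distinct [a, b, c] \<and> X = {a, b, c} \<and>
      ({a, b} \<in> edges G \<longleftrightarrow> ({0, 1} \<in> edges H) = t) \<and>
      ({a, c} \<in> edges G \<longleftrightarrow> ({0, 2} \<in> edges H) = t) \<and>
      ({b, c} \<in> edges G \<longleftrightarrow> ({1, 2} \<in> edges H) = t))"
    unfolding ex_list3 all by (simp add: eq_commute[of X])
  finally show ?thesis by (simp add: mem_copies_co_iff[OF loops H])
qed

lemma mem_copies_co_4_iff: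
  fixes H :: "nat ugraph"
  assumes loops: "\<And>v. {v} \<notin> edges G" "\<And>i. {i} \<notin> edges H"
    and H: "verts H = {..<4}"
  shows "X \<in> copies_co H G \<longleftrightarrow> X \<subseteq> verts G \<and>
    (\<exists>a b c d t. distinct [a, b, c, d] \<and> X = {a, b, c, d} \<and>
      ({a, b} \<in> edges G \<longleftrightarrow> ({0, 1} \<in> edges H) = t) \<and>
      ({a, c} \<in> edges G \<longleftrightarrow> ({0, 2} \<in> edges H) = t) \<and>
      ({b, c} \<in> edges G \<longleftrightarrow> ({1, 2} \<in> edges H) = t) \<and>
      ({a, d} \<in> edges G \<longleftrightarrow> ({0, 3} \<in> edges H) = t) \<and>
      ({b, d} \<in> edges G \<longleftrightarrow> ({1, 3} \<in> edges H) = t) \<and>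
      ({c, d} \<in> edges G \<longleftrightarrow> ({2, 3} \<in> edges H) = t))"
proof -
  have all: "(\<forall>j<4. \<forall>i<j. R i j) \<longleftrightarrow> R 0 1 \<and> R 0 2 \<and> R 1 2 \<and> R 0 3 \<and> R 1 3 \<and> R 2 (3::nat)" for R
    by (auto simp: eval_nat_numeral All_less_Suc)
  have "(\<exists>xs t. distinct xs \<and> length xs = 4 \<and> set xs = X \<and>
      (\<forall>j<4. \<forall>i<j. {xs ! i, xs ! j} \<in> edges G \<longleftrightarrow> ({i, j} \<in> edges H) = t))
    \<longleftrightarrow> (\<exists>xs. length xs = 4 \<and> (\<exists>t. distinct xs \<and> set xs = X \<and>
      (\<forall>j<4. \<forall>i<j. {xs ! i, xs ! j} \<in> edges G \<longleftrightarrow> ({i, j} \<in> edges H) = t)))"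
    by blast
  also have "\<dots> \<longleftrightarrow> (\<exists>a b c d t. distinct [a, b, c, d] \<and> X = {a, b, c, d} \<and>
      ({a, b} \<in> edges G \<longleftrightarrow> ({0, 1} \<in> edges H) = t) \<and>
      ({a, c} \<in> edges G \<longleftrightarrow> ({0, 2} \<in> edges H) = t) \<and>
      ({b, c} \<in> edges G \<longleftrightarrow> ({1, 2} \<in> edges H) = t) \<and>
      ({a, d} \<in> edges G \<longleftrightarrow> ({0, 3} \<in> edges H) = t) \<and>
      ({b, d} \<in> edges G \<longleftrightarrow> ({1, 3} \<in> edges H) = t) \<and>
      ({c, d} \<in> edges G \<longleftrightarrow> ({2, 3} \<in> edges H) = t))"
    unfolding ex_list4 all by (simp add: eq_commute[of X])
  finally show ?thesis by (simp add: mem_copies_co_iff[OF loops H])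
qed

lemma edges_complete_graph: "{i, j} \<in> edges (complete_graph t) \<longleftrightarrow> i < t \<and> j < t \<and> i \<noteq> j"
  by (auto simp: complete_graph_def doubleton_eq_iff)

lemma edges_path_graph:
  "{i, j} \<in> edges (path_graph t) \<longleftrightarrow> i < t \<and> j < t \<and> (j = Suc i \<or> i = Suc j)"
  by (auto simp: path_graph_def doubleton_eq_iff)

lemma edges_cycle_graph:
  "{i, j} \<in> edges (cycle_graph t) \<longleftrightarrow> i < t \<and> j < t \<and> (j = Suc i mod t \<or> i = Suc j mod t)"
  by (auto simp: cycle_graph_def doubleton_eq_iff)

lemma edges_complete_bipartite:
  "{i, j} \<in> edges (complete_bipartite s t)
    \<longleftrightarrow> i < s \<and> s \<le> j \<and> j < s + t \<or> j < s \<and> s \<le> i \<and> i < s + t"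
  by (auto simp: complete_bipartite_def doubleton_eq_iff)

lemma edges_diamond:
  "{i, j} \<in> edges diamond \<longleftrightarrow> i < 4 \<and> j < 4 \<and> i \<noteq> j \<and> {i, j} \<noteq> {0, 1}"
  by (simp add: diamond_def edges_complete_graph)

lemma edges_paw:
  "{i, j} \<in> edges paw \<longleftrightarrow> i < 4 \<and> j < 4 \<and> i \<noteq> j \<and> {i, j} \<noteq> {0, 1} \<and> {i, j} \<noteq> {0, 2}"
  by (simp add: paw_def edges_complete_graph)

lemmas small_graph_edges = edges_complete_graph edges_path_graph edges_cycle_graph
  edges_complete_bipartite edges_diamond edges_paw

lemma small_graph_verts:
  "verts (complete_graph t) = {..<t}" "verts (path_graph t) = {..<t}"
  "verts (cycle_graph t) = {..<t}" "verts (complete_bipartite s u) = {..<s + u}"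
  "verts diamond = {..<4}" "verts paw = {..<4}"
  by (simp_all add: complete_graph_def path_graph_def cycle_graph_def complete_bipartite_def
      diamond_def paw_def)

lemma small_graph_loopless:
  "{i} \<notin> edges (complete_graph t)" "{i} \<notin> edges (path_graph t)"
  "{i} \<notin> edges (cycle_graph 4)" "{i} \<notin> edges (complete_bipartite s u)"
  "{i} \<notin> edges diamond" "{i} \<notin> edges paw"
proof -
  have "{i, i} \<notin> edges (cycle_graph 4)"
    unfolding edges_cycle_graph by presburger
  then show "{i} \<notin> edges (cycle_graph 4)" by simp
qed (use small_graph_edges[of i i] in auto)

text \<open>The pairs are seen as coloured by adjacency and nonadjacency.\<close>

definition monochromatic :: "'a ugraph \<Rightarrow> 'a \<Rightarrow> 'a \<Rightarrow> 'a \<Rightarrow> bool" where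
  "monochromatic G a b c \<longleftrightarrow> ({a, b} \<in> edges G \<longleftrightarrow> {a, c} \<in> edges G)
    \<and> ({a, b} \<in> edges G \<longleftrightarrow> {b, c} \<in> edges G)"

text \<open>In terms of signs, the products over the perfect matchings $ab|cd$, $ac|bd$ and $ad|bc$ are
  equal.\<close>

definition matchings_agree :: "'a ugraph \<Rightarrow> 'a \<Rightarrow> 'a \<Rightarrow> 'a \<Rightarrow> 'a \<Rightarrow> bool" where
  "matchings_agree G a b c d \<longleftrightarrow>
    (({a, b} \<in> edges G \<longleftrightarrow> {c, d} \<in> edges G) \<longleftrightarrow> ({a, c} \<in> edges G \<longleftrightarrow> {b, d} \<in> edges G)) \<and>
    (({a, b} \<in> edges G \<longleftrightarrow> {c, d} \<in> edges G) \<longleftrightarrow> ({a, d} \<in> edges G \<longleftrightarrow> {b, c} \<in> edges G))"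

lemma matchings_agree_permute:
  assumes "distinct [a, b, c, d]" "distinct [a', b', c', d']" "{a, b, c, d} = {a', b', c', d'}"
  shows "matchings_agree G a b c d \<longleftrightarrow> matchings_agree G a' b' c' d'"
proof -
  have "a' \<in> {a, b, c, d}" "b' \<in> {a, b, c, d}" "c' \<in> {a, b, c, d}" "d' \<in> {a, b, c, d}"
    using assms(3) by auto
  with assms(1,2) show ?thesis
    unfolding insert_iff empty_iff matchings_agree_def
    by (elim disjE) (simp_all add: insert_commute, argo+)
qed


lemma monochromatic_permute:
  assumes "distinct [a, b, c]" "distinct [a', b', c']" "{a, b, c} = {a', b', c'}"
  shows "monochromatic G a b c \<longleftrightarrow> monochromatic G a' b' c'"
proof -
  have "a' \<in> {a, b, c}" "b' \<in> {a, b, c}" "c' \<in> {a, b, c}"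
    using assms(3) by auto
  with assms(1,2) show ?thesis
    unfolding insert_iff empty_iff monochromatic_def
    by (elim disjE) (simp_all add: insert_commute, argo+)
qed

definition agreeing_quadruples :: "'a ugraph \<Rightarrow> 'a set set" where
  "agreeing_quadruples G = copies_co (complete_graph 4) G \<union> copies_co (complete_bipartite 1 3) G
     \<union> copies_co (cycle_graph 4) G"

definition disagreeing_quadruples :: "'a ugraph \<Rightarrow> 'a set set" where
  "disagreeing_quadruples G = copies_co (path_graph 4) G \<union> copies_co paw G \<union> copies_co diamond G"

context
  fixes G :: "'a ugraph"
  assumes loopless: "\<And>v. {v} \<notin> edges G"
begin

lemmas small_copies_iff = 
  mem_copies_co_3_iff[OF loopless small_graph_loopless(1) small_graph_verts(1)]
  mem_copies_co_3_iff[OF loopless small_graph_loopless(2) small_graph_verts(2)]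
  mem_copies_co_4_iff[OF loopless small_graph_loopless(1) small_graph_verts(1)]
  mem_copies_co_4_iff[OF loopless small_graph_loopless(2) small_graph_verts(2)]
  mem_copies_co_4_iff[OF loopless small_graph_loopless(3) small_graph_verts(3)]
  mem_copies_co_4_iff[OF loopless small_graph_loopless(4) small_graph_verts(4)[of 1 3, simplified]]
  mem_copies_co_4_iff[OF loopless small_graph_loopless(5) small_graph_verts(5)]
  mem_copies_co_4_iff[OF loopless small_graph_loopless(6) small_graph_verts(6)]

text \<open>In the following patterns each pair is compared with one fixed reference pair. Whether the
  reference pair is an edge decides between the small graph and its complement.\<close>

lemma mem_copies_co_K3:
  "X \<in> copies_co (complete_graph 3) G \<longleftrightarrow> X \<subseteq> verts G \<and>
    (\<exists>a b c. distinct [a, b, c] \<and> X = {a, b, c} \<and>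
      ({a, c} \<in> edges G \<longleftrightarrow> {a, b} \<in> edges G) \<and>
      ({b, c} \<in> edges G \<longleftrightarrow> {a, b} \<in> edges G))"
  by (simp add: small_copies_iff small_graph_edges doubleton_eq_iff del: distinct.simps)

lemma mem_copies_co_P3:
  "X \<in> copies_co (path_graph 3) G \<longleftrightarrow> X \<subseteq> verts G \<and>
    (\<exists>a b c. distinct [a, b, c] \<and> X = {a, b, c} \<and>
      ({a, c} \<in> edges G \<longleftrightarrow> {a, b} \<notin> edges G) \<and>
      ({b, c} \<in> edges G \<longleftrightarrow> {a, b} \<in> edges G))"
  by (simp add: small_copies_iff small_graph_edges doubleton_eq_iff del: distinct.simps)

lemma mem_copies_co_K4:
  "X \<in> copies_co (complete_graph 4) G \<longleftrightarrow> X \<subseteq> verts G \<and>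
    (\<exists>a b c d. distinct [a, b, c, d] \<and> X = {a, b, c, d} \<and>
      ({a, c} \<in> edges G \<longleftrightarrow> {a, b} \<in> edges G) \<and>
      ({b, c} \<in> edges G \<longleftrightarrow> {a, b} \<in> edges G) \<and>
      ({a, d} \<in> edges G \<longleftrightarrow> {a, b} \<in> edges G) \<and>
      ({b, d} \<in> edges G \<longleftrightarrow> {a, b} \<in> edges G) \<and>
      ({c, d} \<in> edges G \<longleftrightarrow> {a, b} \<in> edges G))"
  by (simp add: small_copies_iff small_graph_edges doubleton_eq_iff del: distinct.simps)

lemma mem_copies_co_P4:
  "X \<in> copies_co (path_graph 4) G \<longleftrightarrow> X \<subseteq> verts G \<and>
    (\<exists>a b c d. distinct [a, b, c, d] \<and> X = {a, b, c, d} \<and>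
      ({a, c} \<in> edges G \<longleftrightarrow> {a, b} \<notin> edges G) \<and>
      ({b, c} \<in> edges G \<longleftrightarrow> {a, b} \<in> edges G) \<and>
      ({a, d} \<in> edges G \<longleftrightarrow> {a, b} \<notin> edges G) \<and>
      ({b, d} \<in> edges G \<longleftrightarrow> {a, b} \<notin> edges G) \<and>
      ({c, d} \<in> edges G \<longleftrightarrow> {a, b} \<in> edges G))"
  by (simp add: small_copies_iff small_graph_edges doubleton_eq_iff del: distinct.simps)

lemma mem_copies_co_C4:
  "X \<in> copies_co (cycle_graph 4) G \<longleftrightarrow> X \<subseteq> verts G \<and>
    (\<exists>a b c d. distinct [a, b, c, d] \<and> X = {a, b, c, d} \<and>
      ({a, c} \<in> edges G \<longleftrightarrow> {a, b} \<notin> edges G) \<and>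
      ({b, c} \<in> edges G \<longleftrightarrow> {a, b} \<in> edges G) \<and>
      ({a, d} \<in> edges G \<longleftrightarrow> {a, b} \<in> edges G) \<and>
      ({b, d} \<in> edges G \<longleftrightarrow> {a, b} \<notin> edges G) \<and>
      ({c, d} \<in> edges G \<longleftrightarrow> {a, b} \<in> edges G))"
  by (simp add: small_copies_iff small_graph_edges doubleton_eq_iff del: distinct.simps)

lemma mem_copies_co_K13:
  "X \<in> copies_co (complete_bipartite 1 3) G \<longleftrightarrow> X \<subseteq> verts G \<and>
    (\<exists>a b c d. distinct [a, b, c, d] \<and> X = {a, b, c, d} \<and>
      ({a, c} \<in> edges G \<longleftrightarrow> {a, b} \<in> edges G) \<and>
      ({b, c} \<in> edges G \<longleftrightarrow> {a, b} \<notin> edges G) \<and>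
      ({a, d} \<in> edges G \<longleftrightarrow> {a, b} \<in> edges G) \<and>
      ({b, d} \<in> edges G \<longleftrightarrow> {a, b} \<notin> edges G) \<and>
      ({c, d} \<in> edges G \<longleftrightarrow> {a, b} \<notin> edges G))"
  by (simp add: small_copies_iff small_graph_edges doubleton_eq_iff del: distinct.simps)

lemma mem_copies_co_diamond:
  "X \<in> copies_co diamond G \<longleftrightarrow> X \<subseteq> verts G \<and>
    (\<exists>a b c d. distinct [a, b, c, d] \<and> X = {a, b, c, d} \<and>
      ({a, b} \<in> edges G \<longleftrightarrow> {a, c} \<notin> edges G) \<and>
      ({b, c} \<in> edges G \<longleftrightarrow> {a, c} \<in> edges G) \<and>
      ({a, d} \<in> edges G \<longleftrightarrow> {a, c} \<in> edges G) \<and>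
      ({b, d} \<in> edges G \<longleftrightarrow> {a, c} \<in> edges G) \<and>
      ({c, d} \<in> edges G \<longleftrightarrow> {a, c} \<in> edges G))"
  by (simp add: small_copies_iff small_graph_edges doubleton_eq_iff del: distinct.simps)

lemma mem_copies_co_paw:
  "X \<in> copies_co paw G \<longleftrightarrow> X \<subseteq> verts G \<and>
    (\<exists>a b c d. distinct [a, b, c, d] \<and> X = {a, b, c, d} \<and>
      ({a, b} \<in> edges G \<longleftrightarrow> {b, c} \<notin> edges G) \<and>
      ({a, c} \<in> edges G \<longleftrightarrow> {b, c} \<notin> edges G) \<and>
      ({a, d} \<in> edges G \<longleftrightarrow> {b, c} \<in> edges G) \<and>
      ({b, d} \<in> edges G \<longleftrightarrow> {b, c} \<in> edges G) \<and>
      ({c, d} \<in> edges G \<longleftrightarrow> {b, c} \<in> edges G))"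
  by (simp add: small_copies_iff small_graph_edges doubleton_eq_iff del: distinct.simps)

lemma agreeing_quadruples_imp:
  assumes "X \<in> agreeing_quadruples G"
  shows "\<exists>a b c d. distinct [a, b, c, d] \<and> X = {a, b, c, d} \<and> matchings_agree G a b c d"
  using assms unfolding agreeing_quadruples_def mem_copies_co_K4 mem_copies_co_C4
    mem_copies_co_K13 Un_iff
  by (elim disjE conjE exE) (intro exI conjI, assumption, assumption, simp add: matchings_agree_def)+

lemma disagreeing_quadruples_imp:
  assumes "X \<in> disagreeing_quadruples G"
  shows "\<exists>a b c d. distinct [a, b, c, d] \<and> X = {a, b, c, d} \<and> \<not> matchings_agree G a b c d"
  using assms unfolding disagreeing_quadruples_def mem_copies_co_P4 mem_copies_co_paw
    mem_copies_co_diamond Un_iff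
  by (elim disjE conjE exE) (intro exI conjI, assumption, assumption, simp add: matchings_agree_def)+

lemma monochromatic_triples_imp:
  assumes "X \<in> copies_co (complete_graph 3) G"
  shows "\<exists>a b c. distinct [a, b, c] \<and> X = {a, b, c} \<and> monochromatic G a b c"
  using assms unfolding mem_copies_co_K3 monochromatic_def by metis

lemma nonmonochromatic_triples_imp:
  assumes "X \<in> copies_co (path_graph 3) G"
  shows "\<exists>a b c. distinct [a, b, c] \<and> X = {a, b, c} \<and> \<not> monochromatic G a b c"
  using assms unfolding mem_copies_co_P3 monochromatic_def by metis

text \<open>If the three signs are not equal, one pair differs from the two others; its ends are the ends
  of the path.\<close>

lemma triple_cover:
  assumes "distinct [a, b, c]" "{a, b, c} \<subseteq> verts G"
  shows "{a, b, c} \<in> copies_co (if monochromatic G a b c then complete_graph 3 else path_graph 3) G"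
proof (cases "monochromatic G a b c")
  case True
  with assms show ?thesis unfolding monochromatic_def by (auto simp: mem_copies_co_K3)
next
  case False
  have P3: "{x, y, z} \<in> copies_co (path_graph 3) G"
    if "distinct [x, y, z]" "{x, y, z} \<subseteq> verts G"
      "{x, z} \<in> edges G \<longleftrightarrow> {x, y} \<notin> edges G" "{y, z} \<in> edges G \<longleftrightarrow> {x, y} \<in> edges G" for x y z
    using that unfolding mem_copies_co_P3 by blast
  have "{a, b, c} \<in> copies_co (path_graph 3) G"
    using P3[of a b c] P3[of b a c] P3[of a c b] assms False
    unfolding monochromatic_def by (simp add: insert_commute) argo
  then show ?thesis using False by simp
qed

text \<open>Every labelled graph on four vertices matches one of the patterns in a suitable order of the
  vertices. All orders up to the symmetries of the pattern are listed, which leaves a propositional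
  problem about the six pairs.\<close>

lemma quadruple_cover:
  assumes "distinct [a, b, c, d]" "{a, b, c, d} \<subseteq> verts G"
  shows "{a, b, c, d} \<in> (if matchings_agree G a b c d then agreeing_quadruples G
    else disagreeing_quadruples G)"
proof -
  have K4: "{x, y, z, u} \<in> agreeing_quadruples G"
    if "distinct [x, y, z, u]" "{x, y, z, u} \<subseteq> verts G"
      "{x, z} \<in> edges G \<longleftrightarrow> {x, y} \<in> edges G"
      "{y, z} \<in> edges G \<longleftrightarrow> {x, y} \<in> edges G"
      "{x, u} \<in> edges G \<longleftrightarrow> {x, y} \<in> edges G"
      "{y, u} \<in> edges G \<longleftrightarrow> {x, y} \<in> edges G"
      "{z, u} \<in> edges G \<longleftrightarrow> {x, y} \<in> edges G"
    for x y z u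
    using that unfolding agreeing_quadruples_def mem_copies_co_K4 Un_iff by blast
  have C4: "{x, y, z, u} \<in> agreeing_quadruples G"
    if "distinct [x, y, z, u]" "{x, y, z, u} \<subseteq> verts G"
      "{x, z} \<in> edges G \<longleftrightarrow> {x, y} \<notin> edges G"
      "{y, z} \<in> edges G \<longleftrightarrow> {x, y} \<in> edges G"
      "{x, u} \<in> edges G \<longleftrightarrow> {x, y} \<in> edges G"
      "{y, u} \<in> edges G \<longleftrightarrow> {x, y} \<notin> edges G"
      "{z, u} \<in> edges G \<longleftrightarrow> {x, y} \<in> edges G"
    for x y z u
    using that unfolding agreeing_quadruples_def mem_copies_co_C4 Un_iff by blast
  have K13: "{x, y, z, u} \<in> agreeing_quadruples G"
    if "distinct [x, y, z, u]" "{x, y, z, u} \<subseteq> verts G"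
      "{x, z} \<in> edges G \<longleftrightarrow> {x, y} \<in> edges G"
      "{y, z} \<in> edges G \<longleftrightarrow> {x, y} \<notin> edges G"
      "{x, u} \<in> edges G \<longleftrightarrow> {x, y} \<in> edges G"
      "{y, u} \<in> edges G \<longleftrightarrow> {x, y} \<notin> edges G"
      "{z, u} \<in> edges G \<longleftrightarrow> {x, y} \<notin> edges G"
    for x y z u
    using that unfolding agreeing_quadruples_def mem_copies_co_K13 Un_iff by blast
  have P4: "{x, y, z, u} \<in> disagreeing_quadruples G"
    if "distinct [x, y, z, u]" "{x, y, z, u} \<subseteq> verts G"
      "{x, z} \<in> edges G \<longleftrightarrow> {x, y} \<notin> edges G"
      "{y, z} \<in> edges G \<longleftrightarrow> {x, y} \<in> edges G"
      "{x, u} \<in> edges G \<longleftrightarrow> {x, y} \<notin> edges G"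
      "{y, u} \<in> edges G \<longleftrightarrow> {x, y} \<notin> edges G"
      "{z, u} \<in> edges G \<longleftrightarrow> {x, y} \<in> edges G"
    for x y z u
    using that unfolding disagreeing_quadruples_def mem_copies_co_P4 Un_iff by blast
  have paw: "{x, y, z, u} \<in> disagreeing_quadruples G"
    if "distinct [x, y, z, u]" "{x, y, z, u} \<subseteq> verts G"
      "{x, y} \<in> edges G \<longleftrightarrow> {y, z} \<notin> edges G"
      "{x, z} \<in> edges G \<longleftrightarrow> {y, z} \<notin> edges G"
      "{x, u} \<in> edges G \<longleftrightarrow> {y, z} \<in> edges G"
      "{y, u} \<in> edges G \<longleftrightarrow> {y, z} \<in> edges G"
      "{z, u} \<in> edges G \<longleftrightarrow> {y, z} \<in> edges G"
    for x y z u
    using that unfolding disagreeing_quadruples_def mem_copies_co_paw Un_iff by blast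
  have diamond: "{x, y, z, u} \<in> disagreeing_quadruples G"
    if "distinct [x, y, z, u]" "{x, y, z, u} \<subseteq> verts G"
      "{x, y} \<in> edges G \<longleftrightarrow> {x, z} \<notin> edges G"
      "{y, z} \<in> edges G \<longleftrightarrow> {x, z} \<in> edges G"
      "{x, u} \<in> edges G \<longleftrightarrow> {x, z} \<in> edges G"
      "{y, u} \<in> edges G \<longleftrightarrow> {x, z} \<in> edges G"
      "{z, u} \<in> edges G \<longleftrightarrow> {x, z} \<in> edges G"
    for x y z u
    using that unfolding disagreeing_quadruples_def mem_copies_co_diamond Un_iff by blast
  show ?thesis
  proof (cases "matchings_agree G a b c d")
    case True
    have "{a, b, c, d} \<in> agreeing_quadruples G"
      using True assms
        K4[of a b c d]
        C4[of a b c d] C4[of a c b d] C4[of a b d c]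
        K13[of a b c d] K13[of b a c d] K13[of c a b d] K13[of d a b c]
      unfolding matchings_agree_def by (simp add: insert_commute) argo
    then show ?thesis using True by simp
  next
    case False
    have "{a, b, c, d} \<in> disagreeing_quadruples G"
      using False assms
        P4[of a b c d] P4[of a b d c] P4[of a c b d] P4[of a c d b]
        P4[of a d b c] P4[of a d c b] P4[of b a c d] P4[of b a d c]
        P4[of b c a d] P4[of b d a c] P4[of c a b d] P4[of c b a d]
        paw[of a b c d] paw[of a b d c] paw[of a c d b] paw[of b a c d]
        paw[of b a d c] paw[of b c d a] paw[of c a b d] paw[of c a d b]
        paw[of c b d a] paw[of d a b c] paw[of d a c b] paw[of d b c a]
        diamond[of a b c d] diamond[of a c b d] diamond[of a d b c] diamond[of b c a d]
        diamond[of b d a c] diamond[of c d a b]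
      unfolding matchings_agree_def by (simp add: insert_commute) argo
    then show ?thesis using False by simp
  qed
qed

lemma mem_monochromatic_triples_iff:
  assumes "distinct [a, b, c]" "{a, b, c} \<subseteq> verts G"
  shows "{a, b, c} \<in> copies_co (complete_graph 3) G \<longleftrightarrow> monochromatic G a b c"
    and "{a, b, c} \<in> copies_co (path_graph 3) G \<longleftrightarrow> \<not> monochromatic G a b c"
proof -
  have "monochromatic G a b c" if "{a, b, c} \<in> copies_co (complete_graph 3) G"
    using monochromatic_triples_imp[OF that] monochromatic_permute[OF assms(1)] by metis
  moreover have "\<not> monochromatic G a b c" if "{a, b, c} \<in> copies_co (path_graph 3) G"
    using nonmonochromatic_triples_imp[OF that] monochromatic_permute[OF assms(1)] by metis
  ultimately show "{a, b, c} \<in> copies_co (complete_graph 3) G \<longleftrightarrow> monochromatic G a b c"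
    and "{a, b, c} \<in> copies_co (path_graph 3) G \<longleftrightarrow> \<not> monochromatic G a b c"
    using triple_cover[OF assms] by metis+
qed

lemma mem_agreeing_quadruples_iff:
  assumes "distinct [a, b, c, d]" "{a, b, c, d} \<subseteq> verts G"
  shows "{a, b, c, d} \<in> agreeing_quadruples G \<longleftrightarrow> matchings_agree G a b c d"
    and "{a, b, c, d} \<in> disagreeing_quadruples G \<longleftrightarrow> \<not> matchings_agree G a b c d"
proof -
  have "matchings_agree G a b c d" if "{a, b, c, d} \<in> agreeing_quadruples G"
    using agreeing_quadruples_imp[OF that] matchings_agree_permute[OF assms(1)] by metis
  moreover have "\<not> matchings_agree G a b c d" if "{a, b, c, d} \<in> disagreeing_quadruples G"
    using disagreeing_quadruples_imp[OF that] matchings_agree_permute[OF assms(1)] by metis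
  ultimately show "{a, b, c, d} \<in> agreeing_quadruples G \<longleftrightarrow> matchings_agree G a b c d"
    and "{a, b, c, d} \<in> disagreeing_quadruples G \<longleftrightarrow> \<not> matchings_agree G a b c d"
    using quadruple_cover[OF assms] by metis+
qed

end

section \<open>Counting blocks through two points\<close>

lemma card_triples_through:
  assumes x: "x \<in> V" and y: "y \<in> V" and xy: "x \<noteq> y"
    and B: "\<And>B. B \<in> \<B> \<Longrightarrow> B \<subseteq> V \<and> card B = 3"
  shows "card {B \<in> \<B>. x \<in> B \<and> y \<in> B} = card {z \<in> V - {x, y}. {x, y, z} \<in> \<B>}"
proof (rule bij_betw_same_card[symmetric])
  show "bij_betw (\<lambda>z. {x, y, z}) {z \<in> V - {x, y}. {x, y, z} \<in> \<B>} {B \<in> \<B>. x \<in> B \<and> y \<in> B}"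
    unfolding bij_betw_def
  proof
    show "inj_on (\<lambda>z. {x, y, z}) {z \<in> V - {x, y}. {x, y, z} \<in> \<B>}"
      by (rule inj_onI) auto
    show "(\<lambda>z. {x, y, z}) ` {z \<in> V - {x, y}. {x, y, z} \<in> \<B>} = {B \<in> \<B>. x \<in> B \<and> y \<in> B}"
    proof
      show "{B \<in> \<B>. x \<in> B \<and> y \<in> B} \<subseteq> (\<lambda>z. {x, y, z}) ` {z \<in> V - {x, y}. {x, y, z} \<in> \<B>}"
      proof
        fix B assume "B \<in> {B \<in> \<B>. x \<in> B \<and> y \<in> B}"
        then have mem: "B \<in> \<B>" "x \<in> B" "y \<in> B" by auto
        have "card (B - {x, y}) = 1"
          using mem B[OF mem(1)] xy by (simp add: card_Diff_subset)
        then obtain z where "B - {x, y} = {z}" by (rule card_1_singletonE)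
        then have "B = {x, y, z}" "z \<in> V - {x, y}" using mem B by blast+
        then show "B \<in> (\<lambda>z. {x, y, z}) ` {z \<in> V - {x, y}. {x, y, z} \<in> \<B>}" using mem by blast
      qed
    qed auto
  qed
qed

text \<open>Each block through $x$ and $y$ arises from the two orders of its two other points.\<close>

lemma card_quadruples_through:
  assumes V: "finite V" and x: "x \<in> V" and y: "y \<in> V" and xy: "x \<noteq> y"
    and B: "\<And>B. B \<in> \<B> \<Longrightarrow> B \<subseteq> V \<and> card B = 4"
  shows "card {(z, w) \<in> (V - {x, y}) \<times> (V - {x, y}). z \<noteq> w \<and> {x, y, z, w} \<in> \<B>}
    = 2 * card {B \<in> \<B>. x \<in> B \<and> y \<in> B}"
proof -
  let ?S = "{(z, w) \<in> (V - {x, y}) \<times> (V - {x, y}). z \<noteq> w \<and> {x, y, z, w} \<in> \<B>}"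
  let ?g = "\<lambda>(z, w). {x, y, z, w}"
  let ?T = "{B \<in> \<B>. x \<in> B \<and> y \<in> B}"
  have fiber: "B \<in> ?g ` ?S \<and> card {p \<in> ?S. ?g p = B} = 2" if mem: "B \<in> ?T" for B
  proof -
    have "card (B - {x, y}) = 2"
      using mem B[of B] xy by (simp add: card_Diff_subset)
    then obtain z w where zw: "B - {x, y} = {z, w}" "z \<noteq> w" by (auto simp: card_2_iff)
    then have Beq: "B = {x, y, z, w}" "z \<in> V - {x, y}" "w \<in> V - {x, y}"
      using mem B[of B] by blast+
    have "{p \<in> ?S. ?g p = B} = {(z, w), (w, z)}"
    proof
      show "{p \<in> ?S. ?g p = B} \<subseteq> {(z, w), (w, z)}"
      proof
        fix p assume p: "p \<in> {p \<in> ?S. ?g p = B}"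
        obtain u v where uv: "p = (u, v)" by fastforce
        then have "{u, v} = B - {x, y}" using p by auto
        then show "p \<in> {(z, w), (w, z)}" using zw uv by (auto simp: doubleton_eq_iff)
      qed
      show "{(z, w), (w, z)} \<subseteq> {p \<in> ?S. ?g p = B}"
        using Beq zw(2) mem by (auto simp: insert_commute)
    qed
    moreover have "(z, w) \<noteq> (w, z)" using zw(2) by simp
    moreover have "(z, w) \<in> ?S" "?g (z, w) = B" using Beq zw(2) mem by auto
    ultimately show ?thesis by (metis (no_types, lifting) card_2_iff image_eqI)
  qed
  have image: "?g ` ?S = ?T" using fiber by auto
  have "finite ?S" by (rule finite_subset[of _ "V \<times> V"]) (use V in auto)
  then have "card ?S = (\<Sum>B\<in>?g ` ?S. \<Sum>p\<in>{p \<in> ?S. ?g p = B}. 1)"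
    unfolding card_eq_sum by (rule sum.image_gen)
  also have "\<dots> = (\<Sum>B\<in>?T. 2)"
    unfolding image using fiber by (intro sum.cong) simp_all
  finally show ?thesis by simp
qed

lemma two_design_triplesI:
  assumes "finite V" and "\<And>B. B \<in> \<B> \<Longrightarrow> B \<subseteq> V \<and> card B = 3"
    and "\<And>x y. x \<in> V \<Longrightarrow> y \<in> V \<Longrightarrow> x \<noteq> y
      \<Longrightarrow> real (card {z \<in> V - {x, y}. {x, y, z} \<in> \<B>}) = lam"
  shows "two_design V \<B> (card V) 3 lam"
  unfolding two_design_def using assms by (simp add: card_triples_through)

lemma two_design_quadruplesI:
  assumes "finite V" and "\<And>B. B \<in> \<B> \<Longrightarrow> B \<subseteq> V \<and> card B = 4"
    and "\<And>x y. x \<in> V \<Longrightarrow> y \<in> V \<Longrightarrow> x \<noteq> y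
      \<Longrightarrow> real (card {(z, w) \<in> (V - {x, y}) \<times> (V - {x, y}). z \<noteq> w \<and> {x, y, z, w} \<in> \<B>})
        = 2 * lam"
  shows "two_design V \<B> (card V) 4 lam"
proof -
  have "real (card {B \<in> \<B>. x \<in> B \<and> y \<in> B}) = lam" if "x \<in> V" "y \<in> V" "x \<noteq> y" for x y
    using assms(3)[OF that] card_quadruples_through[OF assms(1) that assms(2)] by simp
  then show ?thesis unfolding two_design_def using assms(1,2) by blast
qed

context conference_graph
begin

abbreviation s where "s \<equiv> adj_sign G"

context
  fixes x y :: 'a and W :: "'a set" and n :: real
  assumes x: "x \<in> verts G" and y: "y \<in> verts G" and xy: "x \<noteq> y"
  defines "W \<equiv> verts G - {x, y}" and "n \<equiv> real (card (verts G)) - 2"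
begin

lemma sum_W: "(\<Sum>z\<in>W. f z) = (\<Sum>z\<in>verts G. f z) - f x - f y" for f :: "'a \<Rightarrow> real"
proof -
  have "(\<Sum>z\<in>verts G. f z) = (\<Sum>z\<in>{x, y}. f z) + (\<Sum>z\<in>W. f z)"
    unfolding W_def using x y finite_verts sum.subset_diff[of "{x, y}" "verts G" f] by simp
  then show ?thesis using xy by simp
qed

lemma finite_W: "finite W" using finite_verts by (simp add: W_def)

lemma card_W: "real (card W) = n"
  using sum_W[of "\<lambda>_. 1"] by (simp add: n_def)

lemma s_self: "s v v = 0" by (simp add: adj_sign_def)

lemma sum_W_row: "(\<Sum>z\<in>W. s x z) = - s x y" "(\<Sum>z\<in>W. s z y) = - s x y"
  unfolding sum_W using row_sum[OF x] row_sum[OF y]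
  by (simp_all add: s_self adj_sign_commute[of G _ y])

lemma sum_W_product: "(\<Sum>z\<in>W. s x z * s z y) = -1"
  unfolding sum_W using row_product[OF x y xy] by (simp add: s_self)

text \<open>Three signs are equal or not according as $1$ plus their three pairwise products is $4$ or $0$.
  Over the vertices other than $x$ and $y$, each of these products sums to $-1$.\<close>

lemma card_monochromatic: "real (card {z \<in> W. monochromatic G x y z}) = (n - 3) / 4"
proof -
  have "real (card {z \<in> W. monochromatic G x y z})
      = (\<Sum>z\<in>W. if monochromatic G x y z then 1 else 0)"
    using finite_W by (simp add: sum.If_cases Int_def)
  also have "\<dots> = (\<Sum>z\<in>W. (1 + s x y * s x z + s x y * s z y + s x z * s z y) / 4)"
    using xy by (intro sum.cong)
      (auto simp: W_def monochromatic_def adj_sign_def insert_commute)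
  also have "\<dots> = (n + s x y * (\<Sum>z\<in>W. s x z) + s x y * (\<Sum>z\<in>W. s z y)
      + (\<Sum>z\<in>W. s x z * s z y)) / 4"
    by (simp add: sum.distrib sum_distrib_left card_W flip: sum_divide_distrib)
  also have "\<dots> = (n - 3) / 4"
    unfolding sum_W_row sum_W_product using adj_sign_square[OF xy, of G] by simp
  finally show ?thesis .
qed

text \<open>Up to the factor for the pair $x, y$, this sums the products of signs along walks of length
  three from $x$ to $y$ that do not use $x$ and $y$ in between. The inner sum is an entry of $S^2$
  from which the term for a return to $x$ is removed.\<close>

lemma sum_W_path: "(\<Sum>z\<in>W. \<Sum>w\<in>W. (s x y * s z w) * (s x z * s y w)) = 1 - n"
proof -
  have "(\<Sum>z\<in>W. \<Sum>w\<in>W. (s x y * s z w) * (s x z * s y w))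
      = (\<Sum>z\<in>W. s x y * s x z * (\<Sum>w\<in>W. s z w * s w y))"
    by (simp add: sum_distrib_left adj_sign_commute[of G _ y] mult_ac)
  also have "\<dots> = (\<Sum>z\<in>W. s x y * s x z * (-1 - s x z * s x y))"
  proof (rule sum.cong)
    fix z assume "z \<in> W"
    then have z: "z \<in> verts G" "z \<noteq> y" by (auto simp: W_def)
    then show "s x y * s x z * (\<Sum>w\<in>W. s z w * s w y) = s x y * s x z * (-1 - s x z * s x y)"
      unfolding sum_W using row_product[OF z(1) y z(2)]
      by (simp add: s_self adj_sign_commute[of G z])
  qed simp
  also have "\<dots> = (\<Sum>z\<in>W. - (s x y * s x z) - 1)"
  proof (rule sum.cong)
    fix z assume "z \<in> W"
    then have "s x z * s x z = 1" "s x y * s x y = 1"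
      using xy by (auto simp: W_def intro: adj_sign_square)
    then have "(s x y * s x y) * (s x z * s x z) = 1" by simp
    then show "s x y * s x z * (-1 - s x z * s x y) = - (s x y * s x z) - 1"
      by (simp add: algebra_simps)
  qed simp
  also have "\<dots> = - (s x y * (\<Sum>z\<in>W. s x z)) - n"
    by (simp add: sum_subtractf sum_negf sum_distrib_left card_W)
  also have "\<dots> = 1 - n"
    unfolding sum_W_row using adj_sign_square[OF xy, of G] by simp
  finally show ?thesis .
qed

text \<open>Agreement is again detected by the pairwise products, now of the three matchings. Two of them
  contain the sign of the pair $z, w$ and become walks of length three; the third splits into a
  function of $z$ times the same function of $w$.\<close>

lemma card_matchings_agree:
  "real (card {(z, w) \<in> W \<times> W. z \<noteq> w \<and> matchings_agree G x y z w}) = (n - 1) * (n - 3) / 4"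
proof -
  let ?a = "\<lambda>z w. s x y * s z w" and ?b = "\<lambda>z w. s x z * s y w" and ?c = "\<lambda>z w. s x w * s y z"
  let ?F = "\<lambda>z w. (1 + ?a z w * ?b z w + ?a z w * ?c z w + ?b z w * ?c z w) / 4"
  have "{(z, w) \<in> W \<times> W. z \<noteq> w \<and> matchings_agree G x y z w}
      = Sigma W (\<lambda>z. {w \<in> W. z \<noteq> w \<and> matchings_agree G x y z w})" by auto
  then have "real (card {(z, w) \<in> W \<times> W. z \<noteq> w \<and> matchings_agree G x y z w})
      = (\<Sum>z\<in>W. real (card {w \<in> W. z \<noteq> w \<and> matchings_agree G x y z w}))"
    using finite_W by simp
  also have "\<dots> = (\<Sum>z\<in>W. \<Sum>w\<in>W. if z \<noteq> w \<and> matchings_agree G x y z w then 1 else 0)"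
    using finite_W by (simp add: sum.If_cases Int_def)
  \<comment> \<open>On the diagonal \<open>?a\<close> vanishes while \<open>?b\<close> and \<open>?c\<close> are equal, so the formula yields 1/2.\<close>
  also have "\<dots> = (\<Sum>z\<in>W. \<Sum>w\<in>W. ?F z w - (if z = w then 1 / 2 else 0))"
  proof (intro sum.cong refl)
    fix z w assume "z \<in> W" "w \<in> W"
    then have ne: "z \<noteq> x" "z \<noteq> y" "w \<noteq> x" "w \<noteq> y" by (auto simp: W_def)
    then show "(if z \<noteq> w \<and> matchings_agree G x y z w then 1 else 0)
        = ?F z w - (if z = w then 1 / 2 else 0)"
      using xy by (cases "z = w")
        (auto simp: matchings_agree_def adj_sign_def insert_commute)
  qed
  also have "\<dots> = (n * n + (\<Sum>z\<in>W. \<Sum>w\<in>W. ?a z w * ?b z w)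
      + (\<Sum>z\<in>W. \<Sum>w\<in>W. ?a z w * ?c z w) + (\<Sum>z\<in>W. \<Sum>w\<in>W. ?b z w * ?c z w)) / 4 - n / 2"
    using finite_W
    by (simp add: sum_subtractf sum.distrib card_W flip: sum_divide_distrib)
  also have "(\<Sum>z\<in>W. \<Sum>w\<in>W. ?a z w * ?c z w) = (\<Sum>z\<in>W. \<Sum>w\<in>W. ?a z w * ?b z w)"
    by (subst sum.swap) (simp add: adj_sign_commute)
  also have "(\<Sum>z\<in>W. \<Sum>w\<in>W. ?b z w * ?c z w) = (\<Sum>z\<in>W. s x z * s z y) * (\<Sum>w\<in>W. s x w * s w y)"
    unfolding sum_product by (simp add: adj_sign_commute[of G _ y] mult_ac)
  finally show ?thesis
    unfolding sum_W_path sum_W_product by (simp add: field_simps)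
qed

lemma card_matchings_disagree:
  "real (card {(z, w) \<in> W \<times> W. z \<noteq> w \<and> \<not> matchings_agree G x y z w})
    = n * n - n - (n - 1) * (n - 3) / 4"
proof -
  let ?agree = "{(z, w) \<in> W \<times> W. z \<noteq> w \<and> matchings_agree G x y z w}"
  let ?disagree = "{(z, w) \<in> W \<times> W. z \<noteq> w \<and> \<not> matchings_agree G x y z w}"
  let ?diag = "(\<lambda>z. (z, z)) ` W"
  have fin: "finite ?agree" "finite ?disagree" "finite ?diag"
    using finite_W by (auto intro: finite_subset[of _ "W \<times> W"])
  have "W \<times> W = (?agree \<union> ?disagree) \<union> ?diag" by auto
  then have "card (W \<times> W) = card ((?agree \<union> ?disagree) \<union> ?diag)"
    by (rule arg_cong)
  also have "\<dots> = card (?agree \<union> ?disagree) + card ?diag"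
    using fin by (intro card_Un_disjoint finite_UnI) auto
  also have "card (?agree \<union> ?disagree) = card ?agree + card ?disagree"
    using fin by (intro card_Un_disjoint) auto
  also have "card ?diag = card W" by (simp add: card_image inj_on_def)
  finally have "real (card W * card W) = real (card ?agree + card ?disagree + card W)"
    by (simp only: card_cartesian_product)
  then show ?thesis using card_matchings_agree card_W by simp
qed

end


lemma monochromatic_triples_design:
  "two_design (verts G) (copies_co (complete_graph 3) G) (card (verts G)) 3
     (1 / 4 * (real (card (verts G)) - 5))"
proof (rule two_design_triplesI[OF finite_verts])
  show "B \<subseteq> verts G \<and> card B = 3" if B: "B \<in> copies_co (complete_graph 3) G" for B
  proof
    obtain a b c where "distinct [a, b, c]" "B = {a, b, c}"
      using monochromatic_triples_imp[OF loopless B] by blast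
    then show "card B = 3" by simp
    show "B \<subseteq> verts G" using B by (rule copies_co_subset)
  qed
  fix x y assume xy: "x \<in> verts G" "y \<in> verts G" "x \<noteq> y"
  have "{z \<in> verts G - {x, y}. {x, y, z} \<in> copies_co (complete_graph 3) G}
      = {z \<in> verts G - {x, y}. monochromatic G x y z}"
    using xy by (auto simp: mem_monochromatic_triples_iff(1) loopless)
  then show "real (card {z \<in> verts G - {x, y}. {x, y, z} \<in> copies_co (complete_graph 3) G})
      = 1 / 4 * (real (card (verts G)) - 5)"
    using card_monochromatic[OF xy] by simp
qed

lemma nonmonochromatic_triples_design:
  "two_design (verts G) (copies_co (path_graph 3) G) (card (verts G)) 3
     (3 / 4 * (real (card (verts G)) - 1))"
proof (rule two_design_triplesI[OF finite_verts])
  show "B \<subseteq> verts G \<and> card B = 3" if B: "B \<in> copies_co (path_graph 3) G" for B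
  proof
    obtain a b c where "distinct [a, b, c]" "B = {a, b, c}"
      using nonmonochromatic_triples_imp[OF loopless B] by blast
    then show "card B = 3" by simp
    show "B \<subseteq> verts G" using B by (rule copies_co_subset)
  qed
  fix x y assume xy: "x \<in> verts G" "y \<in> verts G" "x \<noteq> y"
  let ?W = "verts G - {x, y}"
  have "{z \<in> ?W. {x, y, z} \<in> copies_co (path_graph 3) G}
      = ?W - {z \<in> ?W. monochromatic G x y z}"
    using xy by (auto simp: mem_monochromatic_triples_iff(2) loopless)
  moreover have "card (?W - {z \<in> ?W. monochromatic G x y z})
      = card ?W - card {z \<in> ?W. monochromatic G x y z}"
    by (rule card_Diff_subset) (use finite_verts in auto)
  moreover have "card {z \<in> ?W. monochromatic G x y z} \<le> card ?W"
    by (rule card_mono) (use finite_verts in auto)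
  ultimately have "real (card {z \<in> ?W. {x, y, z} \<in> copies_co (path_graph 3) G})
      = real (card ?W) - real (card {z \<in> ?W. monochromatic G x y z})"
    by (simp only: of_nat_diff)
  then show "real (card {z \<in> ?W. {x, y, z} \<in> copies_co (path_graph 3) G})
      = 3 / 4 * (real (card (verts G)) - 1)"
    unfolding card_monochromatic[OF xy] card_W[OF xy] by (simp add: field_simps)
qed

lemma agreeing_quadruples_design:
  "two_design (verts G) (agreeing_quadruples G) (card (verts G)) 4
     (1 / 8 * (real (card (verts G)) - 3) * (real (card (verts G)) - 5))"
proof (rule two_design_quadruplesI[OF finite_verts])
  show "B \<subseteq> verts G \<and> card B = 4" if B: "B \<in> agreeing_quadruples G" for B
  proof
    obtain a b c d where "distinct [a, b, c, d]" "B = {a, b, c, d}"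
      using agreeing_quadruples_imp[OF loopless B] by blast
    then show "card B = 4" by simp
    show "B \<subseteq> verts G" using B copies_co_subset[of B _ G] unfolding agreeing_quadruples_def by blast
  qed
  fix x y assume xy: "x \<in> verts G" "y \<in> verts G" "x \<noteq> y"
  let ?W = "verts G - {x, y}"
  have "{(z, w) \<in> ?W \<times> ?W. z \<noteq> w \<and> {x, y, z, w} \<in> agreeing_quadruples G}
      = {(z, w) \<in> ?W \<times> ?W. z \<noteq> w \<and> matchings_agree G x y z w}"
    using xy by (auto simp: mem_agreeing_quadruples_iff(1) loopless)
  then show "real (card {(z, w) \<in> ?W \<times> ?W. z \<noteq> w \<and> {x, y, z, w} \<in> agreeing_quadruples G})
      = 2 * (1 / 8 * (real (card (verts G)) - 3) * (real (card (verts G)) - 5))"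
    using card_matchings_agree[OF xy] by (simp)
qed

lemma disagreeing_quadruples_design:
  "two_design (verts G) (disagreeing_quadruples G) (card (verts G)) 4
     (3 / 8 * (real (card (verts G)) - 1) * (real (card (verts G)) - 3))"
proof (rule two_design_quadruplesI[OF finite_verts])
  show "B \<subseteq> verts G \<and> card B = 4" if B: "B \<in> disagreeing_quadruples G" for B
  proof
    obtain a b c d where "distinct [a, b, c, d]" "B = {a, b, c, d}"
      using disagreeing_quadruples_imp[OF loopless B] by blast
    then show "card B = 4" by simp
    show "B \<subseteq> verts G" using B copies_co_subset[of B _ G] unfolding disagreeing_quadruples_def by blast
  qed
  fix x y assume xy: "x \<in> verts G" "y \<in> verts G" "x \<noteq> y"
  let ?W = "verts G - {x, y}"
  let ?disagree = "{(z, w) \<in> ?W \<times> ?W. z \<noteq> w \<and> \<not> matchings_agree G x y z w}"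
  have "{(z, w) \<in> ?W \<times> ?W. z \<noteq> w \<and> {x, y, z, w} \<in> disagreeing_quadruples G} = ?disagree"
    using xy by (auto simp: mem_agreeing_quadruples_iff(2) loopless)
  moreover have "real (card ?disagree)
      = 2 * (3 / 8 * (real (card (verts G)) - 1) * (real (card (verts G)) - 3))"
    unfolding card_matchings_disagree[OF xy] by (simp add: field_simps)
  ultimately show "real (card {(z, w) \<in> ?W \<times> ?W. z \<noteq> w \<and> {x, y, z, w} \<in> disagreeing_quadruples G})
      = 2 * (3 / 8 * (real (card (verts G)) - 1) * (real (card (verts G)) - 3))"
    by (simp only:)
qed

end

theorem corollary1p2:
  fixes p q r :: nat and G :: "'a::{field,finite} ugraph"
  assumes "prime p" and "r > 0" and "q = p ^ r" and "[q = 1] (mod 4)"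
    and "CARD('a) = q"
    and "odd r \<or> \<not> [p = 3] (mod 4) \<Longrightarrow> G = paley_graph"
    and "even r \<and> [p = 3] (mod 4) \<Longrightarrow>
           G = paley_graph \<or> (\<exists>w. primitive_root w \<and> G = peisert_graph w)"
  shows "two_design (verts G) (copies_co (complete_graph 3) G) q 3 (1 / 4 * (real q - 5))
    \<and> two_design (verts G) (copies_co (path_graph 3) G) q 3 (3 / 4 * (real q - 1))
    \<and> two_design (verts G)
        (copies_co (path_graph 4) G \<union> copies_co paw G \<union> copies_co diamond G)
        q 4 (3 / 8 * (real q - 1) * (real q - 3))
    \<and> two_design (verts G)
        (copies_co (complete_graph 4) G \<union> copies_co (complete_bipartite 1 3) G
           \<union> copies_co (cycle_graph 4) G)
        q 4 (1 / 8 * (real q - 3) * (real q - 5))"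
proof -
  have graph: "conference_graph G \<and> verts G = UNIV"
  proof (cases "G = paley_graph")
    case True
    then show ?thesis
      using conference_graph_paley[where 'a = 'a] assms(4,5) by (simp add: paley_graph_def)
  next
    case False
    then have case2: "even r" "[p = 3] (mod 4)" using assms(6) by blast+
    then obtain w where "primitive_root w" "G = peisert_graph w"
      using assms(7) False by blast
    then show ?thesis
      using conference_graph_peisert[of p r w] case2 assms by (simp add: peisert_graph_def)
  qed
  then interpret conference_graph G by simp
  have q: "card (verts G) = q" using graph assms(5) by simp
  show ?thesis
    using monochromatic_triples_design nonmonochromatic_triples_design
      agreeing_quadruples_design disagreeing_quadruples_design
    unfolding q agreeing_quadruples_def disagreeing_quadruples_def by blast
qed

end
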